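(* Let $T\in\{Q,D\}$, let $A,B$ be disjoint sets, let $X$ be a set and let $c:X\to\widetilde{PT}(B+A\times X)$ be any function. Then for every $x\in X$, \[\mathsf{exec}_c(x)=\bigcup_{\sigma\in\Sigma_c(x)}\mathsf{plays}^\sigma_c(x).\]
   Context: Monads on Set: $P$ is the covariant powerset monad (unit $x\mapsto\{x\}$, multiplication = union); $Q$ is the non-empty finite powerset monad (submonad of $P$); $D$ is the finite distribution monad ($D(X)$ = finitely supported probability distributions on $X$, $\eta^D(x)$ the Dirac distribution, $\mu^D(\Phi)(x)=\sum_{\varphi}\Phi(\varphi)\varphi(x)$, $D(f)$ = pushforward); $[x_i\mapsto p_i]_{i\in I}$ denotes the distribution with weight $p_i$ on $x_i$. For $u\in T(X)$, $\mathsf{supp}\,u$ is $u$ itself if $T=Q$ and the support of $u$ if $T=D$. Define $\delta_X:T(P(X))\to P(T(X))$: for $T=Q$, $\delta(\{U_i\}_{i\in I})=\{\bigcup_{i\in I}V_i\mid \text{each }V_i\text{ a finite non-empty subset of }U_i\}$; for $T=D$, $\delta([U_i\mapsto p_i]_{i\in I})=\{\mu^D([\varphi_i\mapsto p_i]_{i\in I})\mid \varphi_i\in D(X),\ \mathsf{supp}\,\varphi_i\subseteq U_i\}$. The convex closure $\mathsf{cl}_X:P(T(X))\to P(T(X))$ is, for $T=Q$, $\mathsf{cl}(\mathcal U)=\{\bigcup\mathcal V\mid \mathcal V\text{ a finite non-empty subset of }\mathcal U\}$, and for $T=D$, $\mathsf{cl}(U)=\{\mu^D(\Phi)\mid\Phi\in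 D(D(X)),\ \mathsf{supp}\,\Phi\subseteq U\}$. $\widetilde{PT}(X)=\{U\subseteq T(X)\mid \mathsf{cl}(U)=U\}$; this is a monad on Set with unit $x\mapsto\{\eta^T(x)\}$. In its Kleisli category, morphisms $X\to Y$ are functions $f:X\to\widetilde{PT}(Y)$, and composition is $(g\odot f)(x)=g^\sharp(f(x))$ where, for $g:X\to\widetilde{PT}(Y)$ and any $U\subseteq T(X)$, $g^\sharp(U)=\bigcup_{u\in U}\{\mu^T(w)\mid w\in\delta_{T(Y)}(T(g)(u))\}$ (with $g$ regarded as a map $X\to P(T(Y))$). Plays: for $n\in\omega$ let $H^n_X(X)=(XA)^{<n}XB+(XA)^nX$, whose elements are completed plays $x_0a_1x_1\dots a_kx_kb$ with $k<n$ and partial plays $x_0a_1x_1\dots a_nx_n$ ($x_i\in X$, $a_i\in A$, $b\in B$). $(XA)^*XB=\bigcup_n (XA)^{<n}XB$ is the set of all completed plays and $\kappa_n:(XA)^{<n}XB\hookrightarrow (XA)^*XB$ the inclusion. For a partial play $\rho x'$ with last state $x'$ and $u\in B+A\times X$, $\rho x'u$ denotes $\rho x'b$ if $u=b\in B$ and $\rho x'ax''$ if $u=(a,x'')$. Define $E_n:H^n_X(X)\to\widetilde{PT}(H^{n+1}_X(X))$ by $E_n(w)=\{\eta^T(w)\}$ for completed $w$ and $E_n(\rho x')=\{T(u\mapsto\rho x'u)(v)\mid v\in c(x')\}$ for partial $\rho x'$. Let $c^*_0(x)=\{\eta^T(x)\}$ and $c^*_{n+1}=E_n\odot c^*_n$,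 so $c^*_n:X\to\widetilde{PT}(H^n_X(X))$. Execution map: $\mathsf{exec}_c(x)=\mathsf{cl}\big(\bigcup_{n\in\omega}\{T(\kappa_n)(u)\mid u\in c^*_n(x),\ \mathsf{supp}\,u\subseteq (XA)^{<n}XB\}\big)\in\widetilde{PT}((XA)^*XB)$ (this is the unique coalgebra morphism from $c^*$ into the final $\overline{H_X}$-coalgebra on $(XA)^*XB$ in the Kleisli category, where $H_X(Y)=X\times(B+A\times Y)$). Strategies: a strategy from $x\in X$ is a sequence $\sigma=(\sigma_n)_{n\in\omega}$ with $\sigma_0=\eta^T(x)$, $\mathrm{Im}_0=\{x\}$, and for $n\ge0$ functions $\sigma_{n+1}:\mathrm{Im}_n\to T(H^{n+1}_X(X))$ with $\sigma_{n+1}(w)\in E_n(w)$ for all $w\in\mathrm{Im}_n$, where $\mathrm{Im}_{n+1}=\bigcup_{w\in\mathrm{Im}_n}\mathsf{supp}\,\sigma_{n+1}(w)$. $\Sigma_c(x)$ is the set of strategies from $x$. The $n$-step partial outcome is $\mathsf{plays}^\sigma_0(x)=\eta^T(x)$, $\mathsf{plays}^\sigma_{n+1}(x)=\mu^T(T(\sigma_{n+1})(\mathsf{plays}^\sigma_n(x)))\in T(H^{n+1}_X(X))$. The completed outcome is $\mathsf{plays}^\sigma_c(x)=\mathsf{cl}(\bigcup_{n\in\omega}O_n)\in\widetilde{PT}((XA)^*XB)$, where $O_n=\{T(\kappa_n)(\mathsf{plays}^\sigma_n(x))\}$ if $\mathsf{supp}\,\mathsf{plays}^\sigma_n(x)\subseteq(XA)^{<n}XB$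 and $O_n=\emptyset$ otherwise. *)

theory Defs
  imports "HOL-Probability.Probability"
begin

section \<open>The two effects\<close>

text \<open>
  A functor value \<open>T X\<close> is a carrier inside a type depending on \<open>T\<close> only: \<open>'a set\<close> for \<open>Q\<close>,
  \<open>'a pmf\<close> for \<open>D\<close>. On these types the structure of \<open>Q\<close> is singleton, \<open>image\<close>, \<open>Union\<close>,
  and a set is its own support; that of \<open>D\<close> is \<^const>\<open>return_pmf\<close>, \<^const>\<open>map_pmf\<close>,
  \<^const>\<open>join_pmf\<close>, \<^const>\<open>set_pmf\<close>. Every notion is given once for each effect.
\<close>

definition Q_set :: "'a set \<Rightarrow> 'a set set" where
  "Q_set X = {U. U \<subseteq> X \<and> finite U \<and> U \<noteq> {}}"

definition D_set :: "'a set \<Rightarrow> 'a pmf set" where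
  "D_set X = {p. set_pmf p \<subseteq> X \<and> finite (set_pmf p)}"

text \<open>
  The family \<open>(U\<^sub>i)\<^sub>i\<close> in the argument of the distributive map is indexed by the members of the
  set, respectively of the support, so the choice of the \<open>V\<^sub>i\<close> (or of the distributions) is a
  function \<open>\<phi>\<close> of \<open>U\<close>. In the second definition \<open>map_pmf \<phi> \<Theta>\<close> is \<open>[\<phi>\<^sub>i \<mapsto> p\<^sub>i]\<^sub>i\<close>.
\<close>

definition delta_Q :: "'a set set \<Rightarrow> 'a set set" where
  "delta_Q \<Theta> = {\<Union>U\<in>\<Theta>. \<phi> U | \<phi>. \<forall>U\<in>\<Theta>. \<phi> U \<in> Q_set U}"

definition delta_D :: "'a set pmf \<Rightarrow> 'a pmf set" where
  "delta_D \<Theta> = {join_pmf (map_pmf \<phi> \<Theta>) | \<phi>. \<forall>U\<in>set_pmf \<Theta>. \<phi> U \<in> D_set U}"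

definition cl_Q :: "'a set set \<Rightarrow> 'a set set" where
  "cl_Q U = {\<Union>\<V> | \<V>. \<V> \<in> Q_set U}"

definition cl_D :: "'a pmf set \<Rightarrow> 'a pmf set" where
  "cl_D U = {join_pmf \<Phi> | \<Phi>. \<Phi> \<in> D_set U}"

definition PT_Q :: "'a set \<Rightarrow> 'a set set set" where
  "PT_Q X = {U. U \<subseteq> Q_set X \<and> cl_Q U = U}"

definition PT_D :: "'a set \<Rightarrow> 'a pmf set set" where
  "PT_D X = {U. U \<subseteq> D_set X \<and> cl_D U = U}"

definition sharp_Q :: "('x \<Rightarrow> 'y set set) \<Rightarrow> 'x set set \<Rightarrow> 'y set set" where
  "sharp_Q g U = (\<Union>u\<in>U. {\<Union>w | w. w \<in> delta_Q (g ` u)})"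

definition sharp_D :: "('x \<Rightarrow> 'y pmf set) \<Rightarrow> 'x pmf set \<Rightarrow> 'y pmf set" where
  "sharp_D g U = (\<Union>u\<in>U. {join_pmf w | w. w \<in> delta_D (map_pmf g u)})"

definition kcomp_Q :: "('y \<Rightarrow> 'z set set) \<Rightarrow> ('x \<Rightarrow> 'y set set) \<Rightarrow> 'x \<Rightarrow> 'z set set"
    (infixl "\<odot>\<^sub>Q" 55) where
  "(g \<odot>\<^sub>Q f) x = sharp_Q g (f x)"

definition kcomp_D :: "('y \<Rightarrow> 'z pmf set) \<Rightarrow> ('x \<Rightarrow> 'y pmf set) \<Rightarrow> 'x \<Rightarrow> 'z pmf set"
    (infixl "\<odot>\<^sub>D" 55) where
  "(g \<odot>\<^sub>D f) x = sharp_D g (f x)"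


section \<open>Plays\<close>

text \<open>
  The play \<open>x\<^sub>0 a\<^sub>1 x\<^sub>1 \<dots> a\<^sub>k x\<^sub>k b\<close> is \<open>([(x\<^sub>0,a\<^sub>1), \<dots>, (x\<^sub>k\<^sub>-\<^sub>1,a\<^sub>k)], x\<^sub>k, b)\<close>, and without its last
  entry when it is partial.
\<close>

type_synonym ('x, 'a, 'b) completed = "('x \<times> 'a) list \<times> 'x \<times> 'b"
type_synonym ('x, 'a) partial = "('x \<times> 'a) list \<times> 'x"
type_synonym ('x, 'a, 'b) play = "('x, 'a, 'b) completed + ('x, 'a) partial"

definition completed_below ::
    "'x set \<Rightarrow> 'a set \<Rightarrow> 'b set \<Rightarrow> nat \<Rightarrow> ('x, 'a, 'b) completed set" where
  "completed_below X A B n = {xs \<in> lists (X \<times> A). length xs < n} \<times> X \<times> B"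

definition partials :: "'x set \<Rightarrow> 'a set \<Rightarrow> nat \<Rightarrow> ('x, 'a) partial set" where
  "partials X A n = {xs \<in> lists (X \<times> A). length xs = n} \<times> X"

definition H :: "'x set \<Rightarrow> 'a set \<Rightarrow> 'b set \<Rightarrow> nat \<Rightarrow> ('x, 'a, 'b) play set" where
  "H X A B n = completed_below X A B n <+> partials X A n"

definition init :: "'x \<Rightarrow> ('x, 'a, 'b) play" where
  "init x = Inr ([], x)"

text \<open>\<open>\<kappa>\<close> is the inclusion \<open>\<kappa>\<^sub>n\<close> for every \<open>n\<close>: the completed summand of \<open>H X A B n\<close> is a subset
  of the set of all completed plays, so only the injection \<^const>\<open>Inl\<close> has to be removed. It is
  meaningful, and used, on completed plays only.\<close>

definition \<kappa> :: "('x, 'a, 'b) play \<Rightarrow> ('x, 'a, 'b) completed" where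
  "\<kappa> = projl"

fun extend :: "('x, 'a) partial \<Rightarrow> 'b + 'a \<times> 'x \<Rightarrow> ('x, 'a, 'b) play" where
  "extend (xs, x') (Inl b) = Inl (xs, x', b)"
| "extend (xs, x') (Inr (a, x'')) = Inr (xs @ [(x', a)], x'')"

text \<open>The maps \<open>E\<^sub>n\<close> are given by one formula; \<open>E_Q c\<close> and \<open>E_D c\<close> restrict to \<open>E\<^sub>n\<close> on \<open>H X A B n\<close>.\<close>

fun E_Q :: "('x \<Rightarrow> ('b + 'a \<times> 'x) set set) \<Rightarrow> ('x, 'a, 'b) play \<Rightarrow> ('x, 'a, 'b) play set set" where
  "E_Q c (Inl w) = {{Inl w}}"
| "E_Q c (Inr (xs, x')) = {extend (xs, x') ` v | v. v \<in> c x'}"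

fun E_D :: "('x \<Rightarrow> ('b + 'a \<times> 'x) pmf set) \<Rightarrow> ('x, 'a, 'b) play \<Rightarrow> ('x, 'a, 'b) play pmf set" where
  "E_D c (Inl w) = {return_pmf (Inl w)}"
| "E_D c (Inr (xs, x')) = {map_pmf (extend (xs, x')) v | v. v \<in> c x'}"

primrec cstar_Q ::
    "('x \<Rightarrow> ('b + 'a \<times> 'x) set set) \<Rightarrow> nat \<Rightarrow> 'x \<Rightarrow> ('x, 'a, 'b) play set set" where
  "cstar_Q c 0 = (\<lambda>x. {{init x}})"
| "cstar_Q c (Suc n) = E_Q c \<odot>\<^sub>Q cstar_Q c n"

primrec cstar_D ::
    "('x \<Rightarrow> ('b + 'a \<times> 'x) pmf set) \<Rightarrow> nat \<Rightarrow> 'x \<Rightarrow> ('x, 'a, 'b) play pmf set" where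
  "cstar_D c 0 = (\<lambda>x. {return_pmf (init x)})"
| "cstar_D c (Suc n) = E_D c \<odot>\<^sub>D cstar_D c n"

definition exec_Q :: "'x set \<Rightarrow> 'a set \<Rightarrow> 'b set \<Rightarrow> ('x \<Rightarrow> ('b + 'a \<times> 'x) set set) \<Rightarrow> 'x \<Rightarrow>
    ('x, 'a, 'b) completed set set" where
  "exec_Q X A B c x =
     cl_Q (\<Union>n. {\<kappa> ` u | u. u \<in> cstar_Q c n x \<and> u \<subseteq> Inl ` completed_below X A B n})"

definition exec_D :: "'x set \<Rightarrow> 'a set \<Rightarrow> 'b set \<Rightarrow> ('x \<Rightarrow> ('b + 'a \<times> 'x) pmf set) \<Rightarrow> 'x \<Rightarrow>
    ('x, 'a, 'b) completed pmf set" where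
  "exec_D X A B c x =
     cl_D (\<Union>n. {map_pmf \<kappa> u | u. u \<in> cstar_D c n x \<and> set_pmf u \<subseteq> Inl ` completed_below X A B n})"


section \<open>Strategies\<close>

text \<open>
  The component \<open>\<sigma>\<^sub>0 = \<eta> x\<close> of a strategy is determined by \<open>x\<close> and not stored: \<open>\<sigma> n\<close> stands for
  \<open>\<sigma>\<^sub>n\<^sub>+\<^sub>1\<close>, a function with domain \<open>Im\<^sub>n\<close>, that is, an extensional one.
\<close>

primrec Im_Q :: "(nat \<Rightarrow> ('x, 'a, 'b) play \<Rightarrow> ('x, 'a, 'b) play set) \<Rightarrow> 'x \<Rightarrow> nat \<Rightarrow>
    ('x, 'a, 'b) play set" where
  "Im_Q \<sigma> x 0 = {init x}"
| "Im_Q \<sigma> x (Suc n) = (\<Union>w\<in>Im_Q \<sigma> x n. \<sigma> n w)"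

primrec Im_D :: "(nat \<Rightarrow> ('x, 'a, 'b) play \<Rightarrow> ('x, 'a, 'b) play pmf) \<Rightarrow> 'x \<Rightarrow> nat \<Rightarrow>
    ('x, 'a, 'b) play set" where
  "Im_D \<sigma> x 0 = {init x}"
| "Im_D \<sigma> x (Suc n) = (\<Union>w\<in>Im_D \<sigma> x n. set_pmf (\<sigma> n w))"

definition strategies_Q :: "'x set \<Rightarrow> 'a set \<Rightarrow> 'b set \<Rightarrow> ('x \<Rightarrow> ('b + 'a \<times> 'x) set set) \<Rightarrow> 'x \<Rightarrow>
    (nat \<Rightarrow> ('x, 'a, 'b) play \<Rightarrow> ('x, 'a, 'b) play set) set" where
  "strategies_Q X A B c x =
     {\<sigma>. \<forall>n. \<sigma> n \<in> Im_Q \<sigma> x n \<rightarrow>\<^sub>E Q_set (H X A B (Suc n)) \<and> (\<forall>w\<in>Im_Q \<sigma> x n. \<sigma> n w \<in> E_Q c w)}"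

definition strategies_D :: "'x set \<Rightarrow> 'a set \<Rightarrow> 'b set \<Rightarrow> ('x \<Rightarrow> ('b + 'a \<times> 'x) pmf set) \<Rightarrow> 'x \<Rightarrow>
    (nat \<Rightarrow> ('x, 'a, 'b) play \<Rightarrow> ('x, 'a, 'b) play pmf) set" where
  "strategies_D X A B c x =
     {\<sigma>. \<forall>n. \<sigma> n \<in> Im_D \<sigma> x n \<rightarrow>\<^sub>E D_set (H X A B (Suc n)) \<and> (\<forall>w\<in>Im_D \<sigma> x n. \<sigma> n w \<in> E_D c w)}"

primrec plays_Q :: "(nat \<Rightarrow> ('x, 'a, 'b) play \<Rightarrow> ('x, 'a, 'b) play set) \<Rightarrow> 'x \<Rightarrow> nat \<Rightarrow>
    ('x, 'a, 'b) play set" where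
  "plays_Q \<sigma> x 0 = {init x}"
| "plays_Q \<sigma> x (Suc n) = \<Union>(\<sigma> n ` plays_Q \<sigma> x n)"

primrec plays_D :: "(nat \<Rightarrow> ('x, 'a, 'b) play \<Rightarrow> ('x, 'a, 'b) play pmf) \<Rightarrow> 'x \<Rightarrow> nat \<Rightarrow>
    ('x, 'a, 'b) play pmf" where
  "plays_D \<sigma> x 0 = return_pmf (init x)"
| "plays_D \<sigma> x (Suc n) = join_pmf (map_pmf (\<sigma> n) (plays_D \<sigma> x n))"

definition outcome_Q :: "'x set \<Rightarrow> 'a set \<Rightarrow> 'b set \<Rightarrow>
    (nat \<Rightarrow> ('x, 'a, 'b) play \<Rightarrow> ('x, 'a, 'b) play set) \<Rightarrow> 'x \<Rightarrow>
    ('x, 'a, 'b) completed set set" where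
  "outcome_Q X A B \<sigma> x =
     cl_Q (\<Union>n. if plays_Q \<sigma> x n \<subseteq> Inl ` completed_below X A B n then {\<kappa> ` plays_Q \<sigma> x n} else {})"

definition outcome_D :: "'x set \<Rightarrow> 'a set \<Rightarrow> 'b set \<Rightarrow>
    (nat \<Rightarrow> ('x, 'a, 'b) play \<Rightarrow> ('x, 'a, 'b) play pmf) \<Rightarrow> 'x \<Rightarrow>
    ('x, 'a, 'b) completed pmf set" where
  "outcome_D X A B \<sigma> x =
     cl_D (\<Union>n. if set_pmf (plays_D \<sigma> x n) \<subseteq> Inl ` completed_below X A B n
                then {map_pmf \<kappa> (plays_D \<sigma> x n)} else {})"

end

theory Submission
  imports Defs
begin

text \<open>
  Because every \<open>E\<^sub>n(w)\<close> is convex, the Kleisli composite \<open>c\<^sup>*\<^sub>n\<^sub>+\<^sub>1\<close> consists of the results of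
  choosing one \<open>\<psi> w \<in> E\<^sub>n(w)\<close> for each play \<open>w\<close> in the support of some \<open>u \<in> c\<^sup>*\<^sub>n(x)\<close>: several
  choices at the same \<open>w\<close>, or one common choice for several plays \<open>w\<close> with the same \<open>E\<^sub>n(w)\<close>, can be
  merged into, respectively obtained from, one choice per play. Hence \<open>c\<^sup>*\<^sub>n(x)\<close> is the set of
  \<open>n\<close>-step partial outcomes of strategies. Completed outcomes persist at later steps, so finitely
  many of them live at a common step \<open>n\<close>, and since \<open>c\<^sup>*\<^sub>n(x)\<close> is convex, each of their convex
  combinations is the outcome of a single strategy.
\<close>

section \<open>Outcomes of strategies\<close>

text \<open>
  One type \<open>'t\<close> of effects on plays \<open>'p\<close> serves for both monads. \<open>S n\<close> are the plays after \<open>n\<close>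
  steps, \<open>C n\<close> the completed ones among them, and \<open>K n\<close> the effects over \<open>S n\<close>.
\<close>

locale branching_process =
  fixes ret :: "'p \<Rightarrow> 't"
    and bind :: "'t \<Rightarrow> ('p \<Rightarrow> 't) \<Rightarrow> 't"
    and supp :: "'t \<Rightarrow> 'p set"
    and E :: "'p \<Rightarrow> 't set"
    and start :: 'p
    and S C :: "nat \<Rightarrow> 'p set"
    and K :: "nat \<Rightarrow> 't set"
  assumes supp_bind: "supp (bind u f) = (\<Union>w\<in>supp u. supp (f w))"
    and bind_cong: "(\<And>w. w \<in> supp u \<Longrightarrow> f w = g w) \<Longrightarrow> bind u f = bind u g"
    and bind_ret: "bind u ret = u"
    and ret_K: "w \<in> S n \<Longrightarrow> ret w \<in> K n"
    and bind_K: "u \<in> K n \<Longrightarrow> (\<And>w. w \<in> supp u \<Longrightarrow> f w \<in> K m) \<Longrightarrow> bind u f \<in> K m"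
    and supp_K: "u \<in> K n \<Longrightarrow> supp u \<subseteq> S n"
    and start_S: "start \<in> S 0"
    and E_K: "w \<in> S n \<Longrightarrow> E w \<subseteq> K (Suc n)"
    and E_completed: "w \<in> C n \<Longrightarrow> E w = {ret w}"
    and C_Suc: "C n \<subseteq> C (Suc n)"
begin

text \<open>The abstract form of \<open>cstar_Q\<close> and \<open>cstar_D\<close> at a fixed start,
  once the distributive map has been reduced to one choice per play.\<close>

primrec reach :: "nat \<Rightarrow> 't set" where
  "reach 0 = {ret start}"
| "reach (Suc n) = {bind u \<psi> | u \<psi>. u \<in> reach n \<and> (\<forall>w\<in>supp u. \<psi> w \<in> E w)}"

primrec plays :: "(nat \<Rightarrow> 'p \<Rightarrow> 't) \<Rightarrow> nat \<Rightarrow> 't" where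
  "plays \<sigma> 0 = ret start"
| "plays \<sigma> (Suc n) = bind (plays \<sigma> n) (\<sigma> n)"

text \<open>For \<open>u = plays \<sigma> n\<close> the domain \<open>supp u\<close> is
  \<open>Im\<^sub>n\<close>; both instances prove this agreement. Extensionality makes a choice a
  function on exactly that domain.\<close>

definition moves :: "'t \<Rightarrow> nat \<Rightarrow> ('p \<Rightarrow> 't) set" where
  "moves u n = {\<psi>. \<psi> \<in> supp u \<rightarrow>\<^sub>E K (Suc n) \<and> (\<forall>w\<in>supp u. \<psi> w \<in> E w)}"

definition strategies :: "(nat \<Rightarrow> 'p \<Rightarrow> 't) set" where
  "strategies = {\<sigma>. \<forall>n. \<sigma> n \<in> moves (plays \<sigma> n) n}"

section \<open>Reachable effects and prefixes of strategies\<close>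

lemma reach_K: "reach n \<subseteq> K n"
proof (induction n)
  case 0
  then show ?case using ret_K start_S by simp
next
  case (Suc n)
  show ?case
  proof
    fix v assume "v \<in> reach (Suc n)"
    then obtain u \<psi> where u: "u \<in> reach n" "\<And>w. w \<in> supp u \<Longrightarrow> \<psi> w \<in> E w" "v = bind u \<psi>" by auto
    have "u \<in> K n" using u(1) Suc by blast
    moreover have "\<psi> w \<in> K (Suc n)" if "w \<in> supp u" for w
      using that u(2) supp_K[OF \<open>u \<in> K n\<close>] E_K by blast
    ultimately show "v \<in> K (Suc n)" unfolding u(3) by (rule bind_K)
  qed
qed

lemma plays_cong: "(\<And>k. k < n \<Longrightarrow> \<sigma> k = \<tau> k) \<Longrightarrow> plays \<sigma> n = plays \<tau> n"
  by (induction n) auto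

lemma plays_in_reach: "\<sigma> \<in> strategies \<Longrightarrow> plays \<sigma> n \<in> reach n"
proof (induction n)
  case (Suc n)
  then have "\<forall>w\<in>supp (plays \<sigma> n). \<sigma> n w \<in> E w" by (simp add: strategies_def moves_def)
  then show ?case using Suc by simp blast
qed simp

lemma restrict_in_moves:
  assumes "u \<in> reach n" and "\<And>w. w \<in> supp u \<Longrightarrow> \<psi> w \<in> E w"
  shows "restrict \<psi> (supp u) \<in> moves u n"
proof -
  have "\<psi> w \<in> K (Suc n)" if "w \<in> supp u" for w
    using that assms reach_K supp_K E_K by blast
  then show ?thesis using assms(2) by (auto simp: moves_def)
qed

text \<open>The outcome at step \<open>k\<close> depends only on components below \<open>k\<close>,
  so the last choice can be stored at index \<open>n\<close> without disturbing earlier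
  outcomes.\<close>

lemma reach_strategy_prefix:
  assumes "u \<in> reach n"
  shows "\<exists>\<sigma>. (\<forall>k<n. \<sigma> k \<in> moves (plays \<sigma> k) k) \<and> plays \<sigma> n = u"
  using assms
proof (induction n arbitrary: u)
  case 0
  then show ?case by simp
next
  case (Suc n)
  then obtain v \<psi> where v: "v \<in> reach n" "\<And>w. w \<in> supp v \<Longrightarrow> \<psi> w \<in> E w" "u = bind v \<psi>"
    by auto
  obtain \<sigma> where \<sigma>: "\<And>k. k < n \<Longrightarrow> \<sigma> k \<in> moves (plays \<sigma> k) k" "plays \<sigma> n = v"
    using Suc.IH[OF v(1)] by blast
  \<comment> \<open>\<open>moves\<close> asks for an extensional function; by
    \<open>bind_cong\<close> the restriction does not change the result of binding.\<close>
  define \<tau> where "\<tau> = \<sigma>(n := restrict \<psi> (supp v))"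
  have plays_\<tau>: "plays \<tau> k = plays \<sigma> k" if "k \<le> n" for k
    using that by (intro plays_cong) (auto simp: \<tau>_def)
  have "\<tau> k \<in> moves (plays \<tau> k) k" if "k < Suc n" for k
  proof (cases "k = n")
    case True
    then show ?thesis
      using restrict_in_moves[OF v(1,2)] plays_\<tau>[of n] \<sigma>(2) by (simp add: \<tau>_def)
  next
    case False
    then show ?thesis using that \<sigma>(1)[of k] plays_\<tau>[of k] by (simp add: \<tau>_def)
  qed
  moreover have "plays \<tau> (Suc n) = u"
    using plays_\<tau>[of n] \<sigma>(2) v(3) by (auto simp: \<tau>_def intro: bind_cong)
  ultimately show ?case by blast
qed

text \<open>Completed plays stay where they are, so \<open>ret\<close> is an admissible choice and
  binding with it gives \<open>u\<close> back.\<close>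

lemma completed_in_reach_Suc:
  assumes "u \<in> reach n" and "supp u \<subseteq> C n"
  shows "u \<in> reach (Suc n)"
proof -
  have "\<forall>w\<in>supp u. ret w \<in> E w" using assms E_completed by fastforce
  then show ?thesis using assms(1) bind_ret[of u] by force
qed

lemma completed_reach_mono:
  "m \<le> n \<Longrightarrow> {u \<in> reach m. supp u \<subseteq> C m} \<subseteq> {u \<in> reach n. supp u \<subseteq> C n}"
proof (induction n rule: dec_induct)
  case (step n)
  then show ?case using completed_in_reach_Suc C_Suc by blast
qed simp

text \<open>A prefix may fail to extend to a strategy, as \<open>E w\<close> can be empty; a completed one extends.\<close>

lemma completed_reach_strategy:
  assumes "u \<in> reach n" and "supp u \<subseteq> C n"
  shows "\<exists>\<sigma>\<in>strategies. plays \<sigma> n = u"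
proof -
  obtain \<sigma> where \<sigma>: "\<And>k. k < n \<Longrightarrow> \<sigma> k \<in> moves (plays \<sigma> k) k" "plays \<sigma> n = u"
    using reach_strategy_prefix[OF assms(1)] by blast
  \<comment> \<open>From step \<open>n\<close> on the strategy stands still, so its domain remains
    \<open>supp u\<close>.\<close>
  define \<tau> where "\<tau> k = (if k < n then \<sigma> k else restrict ret (supp u))" for k
  have before: "plays \<tau> k = plays \<sigma> k" if "k \<le> n" for k
    using that by (intro plays_cong) (auto simp: \<tau>_def)
  have after: "plays \<tau> k = u" if "n \<le> k" for k
    using that
  proof (induction k rule: dec_induct)
    case base
    then show ?case using before[of n] \<sigma>(2) by simp
  next
    case (step k)
    have "\<tau> k = restrict ret (supp u)" using step.hyps by (simp add: \<tau>_def)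
    then have "plays \<tau> (Suc k) = bind u (restrict ret (supp u))" by (simp add: step.IH)
    also have "\<dots> = bind u ret" by (rule bind_cong) simp
    finally show ?case by (simp add: bind_ret)
  qed
  have "\<tau> k \<in> moves (plays \<tau> k) k" for k
  proof (cases "k < n")
    case True
    then show ?thesis using \<sigma>(1) before[of k] by (simp add: \<tau>_def)
  next
    case False
    then have u: "u \<in> reach k"
      using completed_reach_mono[of n k] assms by auto
    have "ret w \<in> E w" if "w \<in> supp u" for w
      using that assms(2) E_completed by fastforce
    then show ?thesis
      using False after[of k] restrict_in_moves[OF u, of ret] by (simp add: \<tau>_def)
  qed
  then show ?thesis
    using before[of n] \<sigma>(2) by (auto simp: strategies_def)
qed

text \<open>\<open>k\<close> stands for the passage to completed plays, so convexity is asked of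
  images under \<open>k\<close>, where \<open>cl\<close> acts. Only the inclusion from left to right
  has to merge strategies; the other follows from \<open>plays_in_reach\<close> by
  monotonicity.\<close>

theorem closure_reach_eq_strategies:
  fixes cl :: "'r set \<Rightarrow> 'r set" and k :: "'t \<Rightarrow> 'r"
  assumes cl_mono: "\<And>U V. U \<subseteq> V \<Longrightarrow> cl U \<subseteq> cl V"
    and cl_extensive: "\<And>U. U \<subseteq> cl U"
    and cl_finitary: "\<And>U v. v \<in> cl U \<Longrightarrow> \<exists>F\<subseteq>U. finite F \<and> v \<in> cl F"
    and convex: "\<And>n. cl (k ` {u \<in> reach n. supp u \<subseteq> C n}) \<subseteq> k ` {u \<in> reach n. supp u \<subseteq> C n}"
  shows "cl (\<Union>n. {k u | u. u \<in> reach n \<and> supp u \<subseteq> C n}) =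
    (\<Union>\<sigma>\<in>strategies. cl (\<Union>n. if supp (plays \<sigma> n) \<subseteq> C n then {k (plays \<sigma> n)} else {}))"
    (is "?L = (\<Union>\<sigma>\<in>strategies. cl (?O \<sigma>))")
proof (intro equalityI subsetI)
  define R where "R n = k ` {u \<in> reach n. supp u \<subseteq> C n}" for n
  fix v assume "v \<in> ?L"
  moreover have "(\<Union>n. {k u | u. u \<in> reach n \<and> supp u \<subseteq> C n}) = (\<Union>n. R n)"
    by (auto simp: R_def)
  ultimately obtain F where F: "F \<subseteq> (\<Union>n. R n)" "finite F" "v \<in> cl F"
    using cl_finitary by metis
  then have "\<forall>z\<in>F. \<exists>n. z \<in> R n" by blast
  then obtain f where f: "\<And>z. z \<in> F \<Longrightarrow> z \<in> R (f z)" by metis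
  \<comment> \<open>The sum bounds every \<open>f z\<close> with \<open>z\<close> in
    \<open>F\<close> and covers an empty \<open>F\<close> without a case distinction.\<close>
  define N where "N = sum f F"
  have "F \<subseteq> R N"
  proof
    fix z assume z: "z \<in> F"
    then have "f z \<le> N" unfolding N_def using F(2) by (intro member_le_sum) auto
    then show "z \<in> R N"
      using f[OF z] completed_reach_mono unfolding R_def by blast
  qed
  then have "v \<in> R N" using F(3) cl_mono convex[of N] unfolding R_def by blast
  then obtain u where u: "u \<in> reach N" "supp u \<subseteq> C N" "v = k u" by (auto simp: R_def)
  then obtain \<sigma> where \<sigma>: "\<sigma> \<in> strategies" "plays \<sigma> N = u"
    using completed_reach_strategy by blast
  \<comment> \<open>The combination is itself the outcome at step \<open>N\<close>, hence a
    generator of the closure for this single strategy.\<close>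
  have "v \<in> ?O \<sigma>" using u \<sigma>(2) by (intro UN_I[of N]) auto
  then have "v \<in> cl (?O \<sigma>)" by (rule subsetD[OF cl_extensive])
  then show "v \<in> (\<Union>\<sigma>\<in>strategies. cl (?O \<sigma>))" by (rule UN_I[OF \<sigma>(1)])
next
  fix v assume "v \<in> (\<Union>\<sigma>\<in>strategies. cl (?O \<sigma>))"
  then obtain \<sigma> where \<sigma>: "\<sigma> \<in> strategies" "v \<in> cl (?O \<sigma>)" by blast
  have "?O \<sigma> \<subseteq> (\<Union>n. {k u | u. u \<in> reach n \<and> supp u \<subseteq> C n})"
    using plays_in_reach[OF \<sigma>(1)] by (auto split: if_splits)
  from cl_mono[OF this] \<sigma>(2) show "v \<in> ?L" by (rule subsetD)
qed

end


section \<open>Plays\<close>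

lemma completed_below_Suc: "completed_below X A B n \<subseteq> completed_below X A B (Suc n)"
  by (auto simp: completed_below_def)

lemma init_in_H: "x \<in> X \<Longrightarrow> init x \<in> H X A B 0"
  by (auto simp: init_def H_def partials_def)

lemma Inl_in_H_Suc: "Inl w \<in> H X A B n \<Longrightarrow> Inl w \<in> H X A B (Suc n)"
  by (auto simp: H_def completed_below_def)

lemma Inr_in_H: "Inr (xs, x') \<in> H X A B n \<Longrightarrow> x' \<in> X"
  by (auto simp: H_def partials_def)

lemma extend_in_H:
  "Inr (xs, x') \<in> H X A B n \<Longrightarrow> v \<in> B <+> A \<times> X \<Longrightarrow> extend (xs, x') v \<in> H X A B (Suc n)"
  by (fastforce simp: H_def partials_def completed_below_def)


section \<open>Non-determinism\<close>

lemma cl_Q_mono: "U \<subseteq> V \<Longrightarrow> cl_Q U \<subseteq> cl_Q V"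
  unfolding cl_Q_def Q_set_def by blast

lemma cl_Q_extensive: "U \<subseteq> cl_Q U"
proof
  fix u assume "u \<in> U"
  then have "{u} \<in> Q_set U" "u = \<Union>{u}" by (auto simp: Q_set_def)
  then show "u \<in> cl_Q U" unfolding cl_Q_def by blast
qed

lemma cl_Q_finitary: "v \<in> cl_Q U \<Longrightarrow> \<exists>F\<subseteq>U. finite F \<and> v \<in> cl_Q F"
  unfolding cl_Q_def Q_set_def by blast

text \<open>Images commute with unions, and a finite subset of an image is the image of a finite
  subset. This moves the closure past \<open>extend (xs, x')\<close> and past
  \<open>\<kappa>\<close>.\<close>

lemma cl_Q_image: "cl_Q ((`) f ` U) = (`) f ` cl_Q U"
proof (intro equalityI subsetI)
  fix v assume "v \<in> cl_Q ((`) f ` U)"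
  then obtain W where W: "W \<subseteq> (`) f ` U" "finite W" "W \<noteq> {}" "v = \<Union>W"
    by (auto simp: cl_Q_def Q_set_def)
  obtain V where V: "V \<subseteq> U" "finite V" "W = (`) f ` V"
    using finite_subset_image[OF W(2,1)] by blast
  then have "V \<in> Q_set U" using W(3) by (auto simp: Q_set_def)
  moreover have "v = f ` \<Union>V" using W(4) V(3) by (simp add: image_Union)
  ultimately show "v \<in> (`) f ` cl_Q U" by (auto simp: cl_Q_def)
next
  fix v assume "v \<in> (`) f ` cl_Q U"
  then obtain V where V: "V \<in> Q_set U" "v = f ` \<Union>V" by (auto simp: cl_Q_def)
  have "(`) f ` V \<in> Q_set ((`) f ` U)" using V(1) by (auto simp: Q_set_def)
  moreover have "v = \<Union>((`) f ` V)" using V(2) by (simp add: image_Union)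
  ultimately show "v \<in> cl_Q ((`) f ` U)" unfolding cl_Q_def by blast
qed

lemma cl_Q_singleton: "cl_Q {u} = {u}"
proof -
  have "Q_set {u} = {{u}}" by (auto simp: Q_set_def)
  then show ?thesis by (simp add: cl_Q_def)
qed

lemma sharp_Q_eq:
  assumes fin: "\<And>u. u \<in> U \<Longrightarrow> finite u"
    and cl: "\<And>u w. u \<in> U \<Longrightarrow> w \<in> u \<Longrightarrow> cl_Q (g w) \<subseteq> g w"
  shows "sharp_Q g U = {\<Union>(\<psi> ` u) | u \<psi>. u \<in> U \<and> (\<forall>w\<in>u. \<psi> w \<in> g w)}"
proof (intro equalityI subsetI)
  fix v assume "v \<in> sharp_Q g U"
  then obtain u \<phi> where u: "u \<in> U" "\<And>w. w \<in> u \<Longrightarrow> \<phi> (g w) \<in> Q_set (g w)"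
    and v: "v = \<Union>(\<Union>V\<in>g ` u. \<phi> V)"
    by (auto simp: sharp_Q_def delta_Q_def)
  \<comment> \<open>The finite family chosen at \<open>g w\<close> collapses to one member by
    convexity.\<close>
  have "\<forall>w\<in>u. \<Union>(\<phi> (g w)) \<in> g w" using u cl by (fastforce simp: cl_Q_def)
  moreover have "v = \<Union>((\<lambda>w. \<Union>(\<phi> (g w))) ` u)" using v by auto
  ultimately show "v \<in> {\<Union>(\<psi> ` u) | u \<psi>. u \<in> U \<and> (\<forall>w\<in>u. \<psi> w \<in> g w)}"
    using u(1) by (intro CollectI exI[of _ u] exI[of _ "\<lambda>w. \<Union>(\<phi> (g w))"]) auto
next
  fix v assume "v \<in> {\<Union>(\<psi> ` u) | u \<psi>. u \<in> U \<and> (\<forall>w\<in>u. \<psi> w \<in> g w)}"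
  then obtain u \<psi> where u: "u \<in> U" "\<And>w. w \<in> u \<Longrightarrow> \<psi> w \<in> g w" and v: "v = \<Union>(\<psi> ` u)" by blast
  \<comment> \<open>\<open>delta_Q\<close> sees only the value \<open>g w\<close>, so the choices at
    all plays sharing this value are gathered; finiteness of \<open>u\<close> makes the family
    finite.\<close>
  define \<phi> where "\<phi> V = \<psi> ` {w \<in> u. g w = V}" for V
  have "\<forall>V\<in>g ` u. \<phi> V \<in> Q_set V"
    using u fin[OF u(1)] by (auto simp: \<phi>_def Q_set_def)
  then have "(\<Union>V\<in>g ` u. \<phi> V) \<in> delta_Q (g ` u)" unfolding delta_Q_def by blast
  moreover have "v = \<Union>(\<Union>V\<in>g ` u. \<phi> V)" unfolding v \<phi>_def by auto
  ultimately show "v \<in> sharp_Q g U" unfolding sharp_Q_def using u(1) by blast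
qed

text \<open>The induction step for convexity of \<open>reach\<close>: in a finite union, the first
  stages \<open>s z\<close> are united, and the choices are united separately at each
  \<open>w\<close>.\<close>

lemma cl_Q_choices:
  assumes U: "cl_Q U \<subseteq> U"
    and fin: "\<And>u. u \<in> U \<Longrightarrow> finite u"
    and cl: "\<And>u w. u \<in> U \<Longrightarrow> w \<in> u \<Longrightarrow> cl_Q (g w) \<subseteq> g w"
  shows "cl_Q {\<Union>(\<psi> ` u) | u \<psi>. u \<in> U \<and> (\<forall>w\<in>u. \<psi> w \<in> g w)}
    \<subseteq> {\<Union>(\<psi> ` u) | u \<psi>. u \<in> U \<and> (\<forall>w\<in>u. \<psi> w \<in> g w)}" (is "cl_Q ?M \<subseteq> ?M")
proof
  fix v assume "v \<in> cl_Q ?M"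
  then obtain V where V: "V \<subseteq> ?M" "finite V" "V \<noteq> {}" "v = \<Union>V"
    by (auto simp: cl_Q_def Q_set_def)
  then have "\<forall>z\<in>V. \<exists>u \<psi>. z = \<Union>(\<psi> ` u) \<and> u \<in> U \<and> (\<forall>w\<in>u. \<psi> w \<in> g w)" by blast
  then obtain s t where st: "\<And>z. z \<in> V \<Longrightarrow> z = \<Union>(t z ` s z)" "\<And>z. z \<in> V \<Longrightarrow> s z \<in> U"
      "\<And>z w. z \<in> V \<Longrightarrow> w \<in> s z \<Longrightarrow> t z w \<in> g w"
    by metis
  \<comment> \<open>Only a \<open>z\<close> with \<open>w\<close> in \<open>s z\<close> offers a
    choice at \<open>w\<close>. For \<open>w\<close> in the united support there is one, so the
    family is non-empty and convexity of \<open>g w\<close> applies.\<close>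
  define \<psi> where "\<psi> w = \<Union>((\<lambda>z. t z w) ` {z \<in> V. w \<in> s z})" for w
  have "s ` V \<in> Q_set U" using V(2,3) st(2) by (auto simp: Q_set_def)
  then have "\<Union>(s ` V) \<in> U" using U by (auto simp: cl_Q_def)
  moreover have "\<psi> w \<in> g w" if "w \<in> \<Union>(s ` V)" for w
  proof -
    have "(\<lambda>z. t z w) ` {z \<in> V. w \<in> s z} \<in> Q_set (g w)"
      using that V(2) st(3) by (auto simp: Q_set_def)
    then have "\<psi> w \<in> cl_Q (g w)" unfolding \<psi>_def cl_Q_def by blast
    then show ?thesis using that cl st(2) by blast
  qed
  moreover have "v = \<Union>(\<psi> ` \<Union>(s ` V))"
  proof -
    have "v = (\<Union>z\<in>V. \<Union>(t z ` s z))" unfolding V(4) using st(1) by auto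
    also have "\<dots> = \<Union>(\<psi> ` \<Union>(s ` V))" unfolding \<psi>_def by blast
    finally show ?thesis .
  qed
  ultimately show "v \<in> ?M" by blast
qed

text \<open>At a partial play the set is an image of \<open>c x'\<close>, and \<open>cl_Q\<close>
  commutes with images; at a completed play it is a singleton.\<close>

lemma E_Q_in_PT_Q:
  assumes c: "\<And>x. x \<in> X \<Longrightarrow> c x \<in> PT_Q (B <+> A \<times> X)" and w: "w \<in> H X A B n"
  shows "E_Q c w \<in> PT_Q (H X A B (Suc n))"
proof (cases w)
  case (Inl z)
  then show ?thesis
    using w Inl_in_H_Suc[of z X A B n] by (auto simp: PT_Q_def cl_Q_singleton Q_set_def)
next
  case (Inr p)
  obtain xs x' where p: "p = (xs, x')" by fastforce
  have E: "E_Q c w = (`) (extend (xs, x')) ` c x'" using Inr p by auto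
  have c': "c x' \<subseteq> Q_set (B <+> A \<times> X)" "cl_Q (c x') = c x'"
    using c[of x'] Inr_in_H[of xs x' X A B n] w Inr p by (auto simp: PT_Q_def)
  have "extend (xs, x') ` v \<in> Q_set (H X A B (Suc n))" if "v \<in> c x'" for v
    using that c'(1) extend_in_H w Inr p by (fastforce simp: Q_set_def)
  then show ?thesis unfolding E PT_Q_def by (auto simp: cl_Q_image c'(2))
qed

lemma theorem6p5_Q:
  assumes c: "\<And>x. x \<in> X \<Longrightarrow> c x \<in> PT_Q (B <+> A \<times> X)" and x: "x \<in> X"
  shows "exec_Q X A B c x = (\<Union>\<sigma>\<in>strategies_Q X A B c x. outcome_Q X A B \<sigma> x)"
proof -
  interpret branching_process "\<lambda>w. {w}" "\<lambda>u f. \<Union>(f ` u)" "\<lambda>u. u" "E_Q c" "init x"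
    "H X A B" "\<lambda>n. Inl ` completed_below X A B n" "\<lambda>n. Q_set (H X A B n)"
  proof (unfold_locales, goal_cases)
    \<comment> \<open>Goal 8 is \<open>E_K\<close>, which rests on the hypothesis about
      \<open>c\<close>.\<close>
    case (8 w n)
    then show ?case using E_Q_in_PT_Q[OF c] by (auto simp: PT_Q_def)
  qed (use completed_below_Suc[of X A B] init_in_H[OF x]
      in \<open>auto simp: Q_set_def\<close>)
  have fin: "finite u" if "u \<in> reach n" for u n
    using that reach_K by (auto simp: Q_set_def)
  have E_convex: "cl_Q (E_Q c w) \<subseteq> E_Q c w" if "u \<in> reach n" "w \<in> u" for u w n
  proof -
    have "w \<in> H X A B n" using that reach_K supp_K by blast
    then show ?thesis using E_Q_in_PT_Q[OF c] by (auto simp: PT_Q_def)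
  qed
  have cstar: "cstar_Q c n x = reach n" for n
  proof (induction n)
    case (Suc n)
    then show ?case
      by (simp add: kcomp_Q_def sharp_Q_eq[OF fin E_convex])
  qed simp
  have reach_convex: "cl_Q (reach n) \<subseteq> reach n" for n
  proof (induction n)
    case 0
    then show ?case by (simp add: cl_Q_singleton)
  next
    case (Suc n)
    then show ?case using cl_Q_choices[OF Suc fin E_convex] by simp
  qed
  have plays: "plays_Q \<sigma> x n = plays \<sigma> n" for \<sigma> n by (induction n) auto
  have Im: "Im_Q \<sigma> x n = plays \<sigma> n" for \<sigma> n by (induction n) auto
  have strategies: "strategies_Q X A B c x = strategies"
    unfolding strategies_Q_def strategies_def moves_def Im by simp
  have convex: "cl_Q ((`) \<kappa> ` {u \<in> reach n. u \<subseteq> Inl ` completed_below X A B n})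
      \<subseteq> (`) \<kappa> ` {u \<in> reach n. u \<subseteq> Inl ` completed_below X A B n}" (is "_ (_ ` ?W) \<subseteq> _") for n
  proof -
    \<comment> \<open>Unions of sets of completed plays contain only completed plays, so convexity
      of \<open>reach n\<close> passes to its completed members.\<close>
    have "cl_Q ?W \<subseteq> cl_Q (reach n)" by (rule cl_Q_mono) auto
    moreover have "u \<subseteq> Inl ` completed_below X A B n" if "u \<in> cl_Q ?W" for u
      using that unfolding cl_Q_def Q_set_def by blast
    ultimately have "cl_Q ?W \<subseteq> ?W" using reach_convex[of n] by blast
    then show ?thesis unfolding cl_Q_image by (rule image_mono)
  qed
  show ?thesis
    unfolding exec_Q_def outcome_Q_def cstar plays strategies
    by (rule closure_reach_eq_strategies[OF cl_Q_mono cl_Q_extensive cl_Q_finitary convex])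
qed


section \<open>Probability\<close>

text \<open>The law of total probability: averaging the conditional laws on the fibres of
  \<open>f\<close> gives \<open>p\<close> back, and associativity carries this over to
  \<open>h\<close>.\<close>

lemma bind_pmf_disintegrate:
  "bind_pmf p h = bind_pmf (map_pmf f p) (\<lambda>y. bind_pmf (cond_pmf p (f -` {y})) h)"
proof -
  have "bind_pmf (map_pmf f p) (\<lambda>y. cond_pmf p {x. y = f x}) = p"
  \<comment> \<open>The relation is \<open>y = f x\<close>; the point \<open>y\<close> has the same
    mass under the image law as its fibre under \<open>p\<close>.\<close>
  proof (rule bind_cond_pmf_cancel)
    fix y x assume "y = f x"
    moreover have "measure (map_pmf f p) {f x} = measure p (f -` {f x})"
      by simp
    moreover have "{z. f x = f z} = f -` {f x}" "{z. z = f x} = {f x}" by auto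
    ultimately show "measure p {x. y = f x} = measure (map_pmf f p) {y. y = f x}" by simp
  qed auto
  moreover have "{x. y = f x} = f -` {y}" for y by auto
  ultimately have "p = bind_pmf (map_pmf f p) (\<lambda>y. cond_pmf p (f -` {y}))" by simp
  then have "bind_pmf p h = bind_pmf (bind_pmf (map_pmf f p) (\<lambda>y. cond_pmf p (f -` {y}))) h"
    by simp
  then show ?thesis by (simp only: bind_assoc_pmf)
qed

section \<open>Closure under finite convex combinations\<close>

lemma cl_D_mono: "U \<subseteq> V \<Longrightarrow> cl_D U \<subseteq> cl_D V"
  unfolding cl_D_def D_set_def by blast

lemma cl_D_extensive: "U \<subseteq> cl_D U"
proof
  fix u assume "u \<in> U"
  then have "return_pmf u \<in> D_set U" "u = join_pmf (return_pmf u)"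
    by (auto simp: D_set_def join_return_pmf)
  then show "u \<in> cl_D U" unfolding cl_D_def by blast
qed

lemma cl_D_finitary: "v \<in> cl_D U \<Longrightarrow> \<exists>F\<subseteq>U. finite F \<and> v \<in> cl_D F"
  unfolding cl_D_def D_set_def by blast

lemma cl_D_map: "cl_D (map_pmf f ` U) = map_pmf f ` cl_D U"
proof (intro equalityI subsetI)
  fix v assume "v \<in> cl_D (map_pmf f ` U)"
  then obtain \<Phi> where \<Phi>: "set_pmf \<Phi> \<subseteq> map_pmf f ` U" "finite (set_pmf \<Phi>)" "v = join_pmf \<Phi>"
    by (auto simp: cl_D_def D_set_def)
  \<comment> \<open>One preimage in \<open>U\<close> is picked for each distribution in the support,
    so pushing \<open>\<Psi>\<close> forward recovers \<open>\<Phi>\<close>.\<close>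
  define \<Psi> where "\<Psi> = map_pmf (inv_into U (map_pmf f)) \<Phi>"
  have "\<Psi> \<in> D_set U"
    using \<Phi>(1,2) by (auto simp: \<Psi>_def D_set_def intro: inv_into_into)
  moreover have "map_pmf (map_pmf f) \<Psi> = \<Phi>"
    using \<Phi>(1) unfolding \<Psi>_def map_pmf_comp
    by (intro map_pmf_idI) (auto intro: f_inv_into_f)
  then have "v = map_pmf f (join_pmf \<Psi>)" by (simp add: map_join_pmf \<Phi>(3))
  ultimately show "v \<in> map_pmf f ` cl_D U" by (auto simp: cl_D_def)
next
  fix v assume "v \<in> map_pmf f ` cl_D U"
  then obtain \<Phi> where \<Phi>: "\<Phi> \<in> D_set U" "v = map_pmf f (join_pmf \<Phi>)" by (auto simp: cl_D_def)
  have "map_pmf (map_pmf f) \<Phi> \<in> D_set (map_pmf f ` U)" using \<Phi>(1) by (auto simp: D_set_def)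
  then show "v \<in> cl_D (map_pmf f ` U)" unfolding cl_D_def \<Phi>(2) map_join_pmf by blast
qed

lemma cl_D_singleton: "cl_D {u} = {u}"
proof -
  have "D_set {u} = {return_pmf u}" by (auto simp: D_set_def set_pmf_subset_singleton)
  then show ?thesis by (simp add: cl_D_def join_return_pmf)
qed

lemma sharp_D_eq:
  assumes fin: "\<And>u. u \<in> U \<Longrightarrow> finite (set_pmf u)"
    and cl: "\<And>u w. u \<in> U \<Longrightarrow> w \<in> set_pmf u \<Longrightarrow> cl_D (g w) \<subseteq> g w"
  shows "sharp_D g U = {bind_pmf u \<psi> | u \<psi>. u \<in> U \<and> (\<forall>w\<in>set_pmf u. \<psi> w \<in> g w)}"
proof (intro equalityI subsetI)
  fix v assume "v \<in> sharp_D g U"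
  then obtain u \<phi> where u: "u \<in> U" "\<And>w. w \<in> set_pmf u \<Longrightarrow> \<phi> (g w) \<in> D_set (g w)"
    and v: "v = join_pmf (join_pmf (map_pmf \<phi> (map_pmf g u)))"
    by (auto simp: sharp_D_def delta_D_def)
  have "\<forall>w\<in>set_pmf u. join_pmf (\<phi> (g w)) \<in> g w" using u cl by (fastforce simp: cl_D_def)
  moreover have "v = bind_pmf u (\<lambda>w. join_pmf (\<phi> (g w)))"
    unfolding v join_pmf_def by (simp add: bind_map_pmf bind_assoc_pmf)
  ultimately show "v \<in> {bind_pmf u \<psi> | u \<psi>. u \<in> U \<and> (\<forall>w\<in>set_pmf u. \<psi> w \<in> g w)}"
    using u(1) by (intro CollectI exI[of _ u] exI[of _ "\<lambda>w. join_pmf (\<phi> (g w))"]) auto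
next
  fix v assume "v \<in> {bind_pmf u \<psi> | u \<psi>. u \<in> U \<and> (\<forall>w\<in>set_pmf u. \<psi> w \<in> g w)}"
  then obtain u \<psi> where u: "u \<in> U" "\<And>w. w \<in> set_pmf u \<Longrightarrow> \<psi> w \<in> g w" and v: "v = bind_pmf u \<psi>"
    by blast
  \<comment> \<open>The law of \<open>\<psi>\<close> under \<open>u\<close> conditioned on
    \<open>g w = V\<close>; disintegrating \<open>u\<close> along \<open>g\<close> then recovers
    \<open>v\<close>.\<close>
  define \<phi> where "\<phi> V = map_pmf \<psi> (cond_pmf u (g -` {V}))" for V
  have "\<phi> V \<in> D_set V" if "V \<in> set_pmf (map_pmf g u)" for V
  proof -
    have "set_pmf (cond_pmf u (g -` {V})) = set_pmf u \<inter> g -` {V}"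
      using that by (intro set_cond_pmf) auto
    then show ?thesis using u fin[OF u(1)] by (auto simp: \<phi>_def D_set_def)
  qed
  then have "join_pmf (map_pmf \<phi> (map_pmf g u)) \<in> delta_D (map_pmf g u)"
    unfolding delta_D_def by blast
  moreover have "v = join_pmf (join_pmf (map_pmf \<phi> (map_pmf g u)))"
    unfolding v bind_pmf_disintegrate[of u \<psi> g] join_pmf_def \<phi>_def
    by (simp add: bind_map_pmf bind_assoc_pmf)
  ultimately show "v \<in> sharp_D g U" unfolding sharp_D_def using u(1) by blast
qed

text \<open>A mixture of two-stage experiments is again one: mixing the first stages stays in
  \<open>U\<close>, and the second stage must be chosen from \<open>w\<close> without knowing the
  component.\<close>

lemma cl_D_choices:
  assumes U: "cl_D U \<subseteq> U"
    and fin: "\<And>u. u \<in> U \<Longrightarrow> finite (set_pmf u)"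
    and cl: "\<And>u w. u \<in> U \<Longrightarrow> w \<in> set_pmf u \<Longrightarrow> cl_D (g w) \<subseteq> g w"
  shows "cl_D {bind_pmf u \<psi> | u \<psi>. u \<in> U \<and> (\<forall>w\<in>set_pmf u. \<psi> w \<in> g w)}
    \<subseteq> {bind_pmf u \<psi> | u \<psi>. u \<in> U \<and> (\<forall>w\<in>set_pmf u. \<psi> w \<in> g w)}" (is "cl_D ?M \<subseteq> ?M")
proof
  fix v assume "v \<in> cl_D ?M"
  then obtain \<Phi> where \<Phi>: "set_pmf \<Phi> \<subseteq> ?M" "finite (set_pmf \<Phi>)" "v = join_pmf \<Phi>"
    by (auto simp: cl_D_def D_set_def)
  then have "\<forall>z\<in>set_pmf \<Phi>. \<exists>u \<psi>. z = bind_pmf u \<psi> \<and> u \<in> U \<and> (\<forall>w\<in>set_pmf u. \<psi> w \<in> g w)"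
    by blast
  then obtain s t where st: "\<And>z. z \<in> set_pmf \<Phi> \<Longrightarrow> z = bind_pmf (s z) (t z)"
      "\<And>z. z \<in> set_pmf \<Phi> \<Longrightarrow> s z \<in> U"
      "\<And>z w. z \<in> set_pmf \<Phi> \<Longrightarrow> w \<in> set_pmf (s z) \<Longrightarrow> t z w \<in> g w"
    by metis
  txt \<open>The choice at \<open>w\<close> is the average of the choices \<open>t z w\<close>, weighted by the conditional
    probability of the component \<open>z\<close> given \<open>w\<close>.\<close>
  define J where "J = bind_pmf \<Phi> (\<lambda>z. map_pmf (\<lambda>w. (w, z)) (s z))"
  define u where "u = join_pmf (map_pmf s \<Phi>)"
  define \<psi> where "\<psi> w = join_pmf (map_pmf (\<lambda>(w, z). t z w) (cond_pmf J (fst -` {w})))" for w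
  have set_J: "set_pmf J = {(w, z). z \<in> set_pmf \<Phi> \<and> w \<in> set_pmf (s z)}"
    by (auto simp: J_def)
  have fin_J: "finite (set_pmf J)"
    using \<Phi>(2) fin st(2) by (auto simp: J_def)
  have fst_J: "map_pmf fst J = u"
    by (simp add: J_def u_def join_pmf_def map_bind_pmf map_pmf_comp bind_map_pmf)
  have "map_pmf s \<Phi> \<in> D_set U" using \<Phi>(2) st(2) by (auto simp: D_set_def)
  then have u: "u \<in> U" using U by (auto simp: u_def cl_D_def)
  moreover have "\<psi> w \<in> g w" if "w \<in> set_pmf u" for w
  proof -
    \<comment> \<open>After conditioning only pairs with first entry \<open>w\<close> remain, and
      their values \<open>t z w\<close> all lie in \<open>g w\<close>.\<close>
    have "set_pmf (cond_pmf J (fst -` {w})) = set_pmf J \<inter> fst -` {w}"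
      using that unfolding fst_J[symmetric] by (intro set_cond_pmf) auto
    then have "map_pmf (\<lambda>(w, z). t z w) (cond_pmf J (fst -` {w})) \<in> D_set (g w)"
      using st(3) fin_J by (auto simp: D_set_def set_J)
    then have "\<psi> w \<in> cl_D (g w)" unfolding \<psi>_def cl_D_def by blast
    then show ?thesis using that cl u by blast
  qed
  moreover have "v = bind_pmf u \<psi>"
  proof -
    have "v = bind_pmf \<Phi> (\<lambda>z. bind_pmf (s z) (t z))"
      unfolding \<Phi>(3) join_pmf_def using st(1) by (intro bind_pmf_cong) auto
    also have "\<dots> = bind_pmf J (\<lambda>(w, z). t z w)"
      by (simp add: J_def bind_assoc_pmf bind_map_pmf)
    \<comment> \<open>The order of sampling is reversed: first \<open>w\<close>, then the component
      \<open>z\<close> given \<open>w\<close>.\<close>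
    also have "\<dots> = bind_pmf (map_pmf fst J)
        (\<lambda>w. bind_pmf (cond_pmf J (fst -` {w})) (\<lambda>(w, z). t z w))"
      by (rule bind_pmf_disintegrate)
    also have "\<dots> = bind_pmf u \<psi>"
      unfolding fst_J \<psi>_def bind_eq_join_pmf[symmetric] ..
    finally show ?thesis .
  qed
  ultimately show "v \<in> ?M" by blast
qed

lemma E_D_in_PT_D:
  assumes c: "\<And>x. x \<in> X \<Longrightarrow> c x \<in> PT_D (B <+> A \<times> X)" and w: "w \<in> H X A B n"
  shows "E_D c w \<in> PT_D (H X A B (Suc n))"
proof (cases w)
  case (Inl z)
  then show ?thesis
    using w Inl_in_H_Suc[of z X A B n] by (auto simp: PT_D_def cl_D_singleton D_set_def)
next
  case (Inr p)
  obtain xs x' where p: "p = (xs, x')" by fastforce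
  have E: "E_D c w = map_pmf (extend (xs, x')) ` c x'" using Inr p by auto
  have c': "c x' \<subseteq> D_set (B <+> A \<times> X)" "cl_D (c x') = c x'"
    using c[of x'] Inr_in_H[of xs x' X A B n] w Inr p by (auto simp: PT_D_def)
  have "map_pmf (extend (xs, x')) v \<in> D_set (H X A B (Suc n))" if "v \<in> c x'" for v
    using that c'(1) extend_in_H w Inr p by (fastforce simp: D_set_def)
  then show ?thesis unfolding E PT_D_def by (auto simp: cl_D_map c'(2))
qed

lemma theorem6p5_D:
  assumes c: "\<And>x. x \<in> X \<Longrightarrow> c x \<in> PT_D (B <+> A \<times> X)" and x: "x \<in> X"
  shows "exec_D X A B c x = (\<Union>\<sigma>\<in>strategies_D X A B c x. outcome_D X A B \<sigma> x)"
proof -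
  interpret branching_process return_pmf bind_pmf set_pmf "E_D c" "init x"
    "H X A B" "\<lambda>n. Inl ` completed_below X A B n" "\<lambda>n. D_set (H X A B n)"
  proof (unfold_locales, goal_cases)
    case (2 u f g)
    then show ?case by (intro bind_pmf_cong) auto
  next
    case (8 w n)
    then show ?case using E_D_in_PT_D[OF c] by (auto simp: PT_D_def)
  qed (use completed_below_Suc[of X A B] init_in_H[OF x]
      in \<open>auto simp: D_set_def bind_return_pmf'\<close>)
  have fin: "finite (set_pmf u)" if "u \<in> reach n" for u n
    using that reach_K by (auto simp: D_set_def)
  have E_convex: "cl_D (E_D c w) \<subseteq> E_D c w" if "u \<in> reach n" "w \<in> set_pmf u" for u w n
  proof -
    have "w \<in> H X A B n" using that reach_K supp_K by blast
    then show ?thesis using E_D_in_PT_D[OF c] by (auto simp: PT_D_def)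
  qed
  have cstar: "cstar_D c n x = reach n" for n
  proof (induction n)
    case (Suc n)
    then show ?case
      by (simp add: kcomp_D_def sharp_D_eq[OF fin E_convex])
  qed simp
  have reach_convex: "cl_D (reach n) \<subseteq> reach n" for n
  proof (induction n)
    case 0
    then show ?case by (simp add: cl_D_singleton)
  next
    case (Suc n)
    then show ?case using cl_D_choices[OF Suc fin E_convex] by simp
  qed
  have plays: "plays_D \<sigma> x n = plays \<sigma> n" for \<sigma> n
    by (induction n) (simp_all add: bind_eq_join_pmf[symmetric])
  have Im: "Im_D \<sigma> x n = set_pmf (plays \<sigma> n)" for \<sigma> n by (induction n) auto
  have strategies: "strategies_D X A B c x = strategies"
    unfolding strategies_D_def strategies_def moves_def Im by simp
  have convex: "cl_D (map_pmf \<kappa> ` {u \<in> reach n. set_pmf u \<subseteq> Inl ` completed_below X A B n})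
      \<subseteq> map_pmf \<kappa> ` {u \<in> reach n. set_pmf u \<subseteq> Inl ` completed_below X A B n}"
    (is "_ (_ ` ?W) \<subseteq> _") for n
  proof -
    have "cl_D ?W \<subseteq> cl_D (reach n)" by (rule cl_D_mono) auto
    moreover have "set_pmf u \<subseteq> Inl ` completed_below X A B n" if "u \<in> cl_D ?W" for u
    proof -
      \<comment> \<open>The support of a mixture is the union of the supports of its components, so
        it contains only completed plays.\<close>
      obtain \<Phi> where "set_pmf \<Phi> \<subseteq> ?W" "u = join_pmf \<Phi>"
        using \<open>u \<in> cl_D ?W\<close> by (auto simp: cl_D_def D_set_def)
      then show ?thesis unfolding \<open>u = join_pmf \<Phi>\<close> set_pmf_join_pmf by blast
    qed
    ultimately have "cl_D ?W \<subseteq> ?W" using reach_convex[of n] by blast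
    then show ?thesis unfolding cl_D_map by (rule image_mono)
  qed
  show ?thesis
    unfolding exec_D_def outcome_D_def cstar plays strategies
    by (rule closure_reach_eq_strategies[OF cl_D_mono cl_D_extensive cl_D_finitary convex])
qed

theorem theorem6p5:
  fixes X :: "'x set" and A :: "'a set" and B :: "'b set"
    and cQ :: "'x \<Rightarrow> ('b + 'a \<times> 'x) set set"
    and cD :: "'x \<Rightarrow> ('b + 'a \<times> 'x) pmf set"
  shows "((\<forall>x\<in>X. cQ x \<in> PT_Q (B <+> A \<times> X)) \<longrightarrow>
           (\<forall>x\<in>X. exec_Q X A B cQ x = (\<Union>\<sigma>\<in>strategies_Q X A B cQ x. outcome_Q X A B \<sigma> x))) \<and>
         ((\<forall>x\<in>X. cD x \<in> PT_D (B <+> A \<times> X)) \<longrightarrow>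
           (\<forall>x\<in>X. exec_D X A B cD x = (\<Union>\<sigma>\<in>strategies_D X A B cD x. outcome_D X A B \<sigma> x)))"
  by (simp add: theorem6p5_Q theorem6p5_D)

end
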